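(* Let $\mathcal A(\mathcal S)$ be a cluster algebra with coefficients in $\mathbb{ZP}$. Suppose that positivity of cluster variables holds for $\mathcal A(\mathcal S)$, i.e. for every cluster $\mathbf x_{t_0}$ every cluster variable of $\mathcal A(\mathcal S)$ is an $\mathbb{NP}$-linear combination of Laurent monomials in $\mathbf x_{t_0}$, and that positivity of $d$-vectors holds for $\mathcal A(\mathcal S)$, i.e. for every cluster $\mathbf x_{t_0}$ and every cluster variable $x\notin\mathbf x_{t_0}$ one has $d^{t_0}(x)\in\mathbb N^n$. Then the cluster monomials of $\mathcal A(\mathcal S)$ are linearly independent over $\mathbb{ZP}$.
   Context: Cluster algebras. A semifield $(\mathbb P,\oplus,\cdot)$ is an abelian multiplicative group with a commutative, associative operation $\oplus$ over which $\cdot$ distributes; its group ring $\mathbb{ZP}$ is a domain, and $\mathbb{NP}\subset\mathbb{ZP}$ denotes the set of finite $\mathbb Z_{\ge0}$-linear combinations of elements of $\mathbb P$ ($\mathbb N=\mathbb Z_{\ge0}$). Let $\mathcal F$ be the field of rational functions in $n$ independent variables with coefficients in $\mathbb{ZP}$. An integer $n\times n$ matrix $B$ is skew-symmetrizable if $SB$ is skew-symmetric for some positive integer diagonal matrix $S$. A seed in $\mathcal F$ is a triple $(\mathbf x,\mathbf y,B)$ where $\mathbf x=\{x_1,\dots,x_n\}$ (the cluster, consisting of cluster variables) is a transcendence basis of $\mathcal F$ over $\mathrm{Frac}(\mathbb{ZP})$ generating $\mathcal F$, $\mathbf y=\{y_1,\dots,y_n\}\subset\mathbb P$ (coefficients),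 and $B=(b_{ij})$ is skew-symmetrizable (exchange matrix). The exchange polynomials are $F_j=\frac{y_j}{1\oplus y_j}\prod_{b_{ij}>0}x_i^{b_{ij}}+\frac{1}{1\oplus y_j}\prod_{b_{ij}<0}x_i^{-b_{ij}}$. The mutation $\mu_k(\mathbf x,\mathbf y,B)=(\mathbf x',\mathbf y',B')$ is given by: $b'_{ij}=-b_{ij}$ if $i=k$ or $j=k$, and $b'_{ij}=b_{ij}+\mathrm{sgn}(b_{ik})\max(b_{ik}b_{kj},0)$ otherwise; $x_i'=x_i$ for $i\ne k$ and $x_k'=F_k/x_k$; $y_k'=y_k^{-1}$ and $y_i'=y_iy_k^{\max(b_{ki},0)}(1\oplus y_k)^{-b_{ki}}$ for $i\neq k$. Let $\mathbb T_n$ be the $n$-regular tree with edges labeled by $1,\dots,n$ so that the edges at each vertex have distinct labels. A cluster pattern $\mathcal S$ assigns to each vertex $t$ a seed $(\mathbf x_t,\mathbf y_t,B_t)$, with $\mathbf x_t=\{x_{1;t},\dots,x_{n;t}\}$, such that seeds at the ends of an edge labeled $k$ are related by $\mu_k$. The cluster algebra $\mathcal A(\mathcal S)$ of rank $n$ is the $\mathbb{ZP}$-subalgebra of $\mathcal F$ generated by all cluster variables of $\mathcal S$. For $\mathbf a\in\mathbb Z^n$, $\mathbf x_t^{\mathbf a}=\prod_i x_{i;t}^{a_i}$ is a Laurent monomial in $\mathbf x_t$; if $\mathbf a\in\mathbb N^n$ it is a cluster monomial in $\mathbf x_t$. The cluster monomials of $\mathcal A(\mathcal S)$ are the elements of $\mathcal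 F$ that are cluster monomials in some cluster. $d$-vectors. By the Laurent phenomenon, for any cluster $\mathbf x_{t_0}$, each cluster variable $x$ can be written uniquely as $x=\frac{f(x_{1;t_0},\dots,x_{n;t_0})}{x_{1;t_0}^{d_1}\cdots x_{n;t_0}^{d_n}}$ with $d_j\in\mathbb Z$ and $f\in\mathbb{ZP}[x_{1;t_0},\dots,x_{n;t_0}]$ not divisible by any $x_{j;t_0}$. The vector $d^{t_0}(x)=(d_1,\dots,d_n)^\top$ is the $d$-vector of $x$ with respect to $\mathbf x_{t_0}$. *)

theory Defs
  imports
    "HOL-Analysis.Finite_Cartesian_Product"
    "HOL-Library.Poly_Mapping"
begin

section \<open>Semifields and their group rings\<close>

class semifield = comm_monoid_mult + inverse +
  fixes oplus :: "'a \<Rightarrow> 'a \<Rightarrow> 'a"  (infixl \<open>\<oplus>\<close> 65)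
  assumes inverse_mult_self: "inverse a * a = 1"
    and divide_eq_mult_inverse: "a / b = a * inverse b"
    and oplus_assoc: "(a \<oplus> b) \<oplus> c = a \<oplus> (b \<oplus> c)"
    and oplus_commute: "a \<oplus> b = b \<oplus> a"
    and mult_oplus_distrib: "a * (b \<oplus> c) = a * b \<oplus> a * c"

lemma mult_inverse_self: "a * inverse a = (1 :: 'a::semifield)"
  using inverse_mult_self[of a] by (simp only: mult.commute)

text \<open>
  The product on \<open>'a \<Rightarrow>\<^sub>0 int\<close> provided by \<^theory>\<open>HOL-Library.Poly_Mapping\<close> is the
  convolution with respect to \<^emph>\<open>addition\<close> on \<open>'a\<close>.  The type \<open>'a additive\<close> is the
  multiplicative group of \<open>'a\<close> written additively, so that \<open>'p additive \<Rightarrow>\<^sub>0 int\<close> is the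
  integral group ring of \<open>'p\<close>.
\<close>

datatype 'a additive = Additive (of_additive: 'a)

instantiation additive :: (semifield) ab_group_add
begin

definition zero_additive :: "'a additive"
  where "zero_additive = Additive 1"

definition plus_additive :: "'a additive \<Rightarrow> 'a additive \<Rightarrow> 'a additive"
  where "plus_additive a b = Additive (of_additive a * of_additive b)"

definition uminus_additive :: "'a additive \<Rightarrow> 'a additive"
  where "uminus_additive a = Additive (inverse (of_additive a))"

definition minus_additive :: "'a additive \<Rightarrow> 'a additive \<Rightarrow> 'a additive"
  where "minus_additive a b = Additive (of_additive a / of_additive b)"

instance
  by standard
    (simp_all add: zero_additive_def plus_additive_def uminus_additive_def minus_additive_def
      inverse_mult_self mult_inverse_self divide_eq_mult_inverse ac_simps)

end

type_synonym 'p group_ring = "'p additive \<Rightarrow>\<^sub>0 int"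

definition group_elem :: "'p::semifield \<Rightarrow> 'p group_ring"
  where "group_elem p = Poly_Mapping.single (Additive p) 1"

text \<open>\<open>\<nat>\<bbbP>\<close>, as a subset of \<open>\<int>\<bbbP>\<close>:\<close>

definition NP :: "'p::semifield group_ring set"
  where "NP = {a. \<forall>p. 0 \<le> Poly_Mapping.lookup a p}"


section \<open>The ambient field\<close>

text \<open>Polynomials in variables indexed by \<open>'n\<close>; exponent vectors are \<open>'n \<Rightarrow>\<^sub>0 nat\<close>.\<close>

type_synonym ('n, 'r) mpoly = "('n \<Rightarrow>\<^sub>0 nat) \<Rightarrow>\<^sub>0 'r"

definition Var :: "'n \<Rightarrow> ('n, 'r::comm_ring_1) mpoly"
  where "Var j = Poly_Mapping.single (Poly_Mapping.single j 1) 1"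

text \<open>Evaluation at \<open>x\<close> after applying \<open>h\<close> to the coefficients:\<close>

definition eval_mpoly ::
    "('r::comm_ring_1 \<Rightarrow> 'f::field) \<Rightarrow> ('n::finite \<Rightarrow> 'f) \<Rightarrow> ('n, 'r) mpoly \<Rightarrow> 'f"
  where "eval_mpoly h x f =
    (\<Sum>m\<in>Poly_Mapping.keys f.
      h (Poly_Mapping.lookup f m) * (\<Prod>i\<in>UNIV. x i ^ Poly_Mapping.lookup m i))"

definition ring_embedding :: "('r::comm_ring_1 \<Rightarrow> 'f::field) \<Rightarrow> bool"
  where "ring_embedding h \<longleftrightarrow>
    h 1 = 1 \<and> (\<forall>a b. h (a + b) = h a + h b) \<and> (\<forall>a b. h (a * b) = h a * h b) \<and> inj h"

definition frac_subfield :: "('r::comm_ring_1 \<Rightarrow> 'f::field) \<Rightarrow> 'f set"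
  where "frac_subfield h = {h a / h b | a b. b \<noteq> 0}"

definition is_subfield :: "'f::field set \<Rightarrow> bool"
  where "is_subfield L \<longleftrightarrow>
    1 \<in> L \<and> (\<forall>a\<in>L. \<forall>b\<in>L. a - b \<in> L \<and> a * b \<in> L) \<and> (\<forall>a\<in>L. inverse a \<in> L)"

definition alg_independent_over :: "'f::field set \<Rightarrow> ('n::finite \<Rightarrow> 'f) \<Rightarrow> bool"
  where "alg_independent_over K x \<longleftrightarrow>
    (\<forall>f :: ('n, 'f) mpoly.
      (\<forall>m. Poly_Mapping.lookup f m \<in> K) \<and> eval_mpoly (\<lambda>c. c) x f = 0 \<longrightarrow> f = 0)"

text \<open>
  A transcendence basis of \<open>'f\<close> over \<open>Frac(\<int>\<bbbP>)\<close> that generates the field \<open>'f\<close>.  That \<open>'f\<close> is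
  algebraic over the subfield generated by \<open>Frac(\<int>\<bbbP>)\<close> and \<open>x\<close> need not be required separately,
  since this subfield is all of \<open>'f\<close>.
\<close>

definition generating_transcendence_basis ::
    "('r::comm_ring_1 \<Rightarrow> 'f::field) \<Rightarrow> ('n::finite \<Rightarrow> 'f) \<Rightarrow> bool"
  where "generating_transcendence_basis h x \<longleftrightarrow>
    alg_independent_over (frac_subfield h) x \<and>
    is_subfield hull (frac_subfield h \<union> range x) = UNIV"

text \<open>
  \<open>'f\<close> is, via \<open>h\<close>, the field of rational functions in the independent variables \<open>u\<close> with
  coefficients in \<open>'r\<close>.
\<close>

definition rational_function_field ::
    "('r::comm_ring_1 \<Rightarrow> 'f::field) \<Rightarrow> ('n::finite \<Rightarrow> 'f) \<Rightarrow> bool"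
  where "rational_function_field h u \<longleftrightarrow>
    ring_embedding h \<and> generating_transcendence_basis h u"


section \<open>Seeds and mutations\<close>

definition skew_symmetrizable :: "int^'n^'n \<Rightarrow> bool"
  where "skew_symmetrizable B \<longleftrightarrow>
    (\<exists>S :: int^'n^'n. (\<forall>i j. i \<noteq> j \<longrightarrow> S $ i $ j = 0) \<and> (\<forall>i. 0 < S $ i $ i) \<and>
      transpose (S ** B) = - (S ** B))"

record ('n::finite, 'p, 'f) seed =
  cluster :: "'n \<Rightarrow> 'f"
  coefficient :: "'n \<Rightarrow> 'p"
  exchange_matrix :: "int^'n^'n"

definition is_seed ::
    "('p::semifield group_ring \<Rightarrow> 'f::field) \<Rightarrow> ('n::finite, 'p, 'f) seed \<Rightarrow> bool"
  where "is_seed h s \<longleftrightarrow>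
    generating_transcendence_basis h (cluster s) \<and> skew_symmetrizable (exchange_matrix s)"

definition exchange_polynomial ::
    "('p::semifield group_ring \<Rightarrow> 'f::field) \<Rightarrow> ('n::finite, 'p, 'f) seed \<Rightarrow> 'n \<Rightarrow> 'f"
  where "exchange_polynomial h s j =
    (let x = cluster s; y = coefficient s; B = exchange_matrix s in
      h (group_elem (y j / (1 \<oplus> y j))) * (\<Prod>i | B $ i $ j > 0. x i powi (B $ i $ j)) +
      h (group_elem (1 / (1 \<oplus> y j))) * (\<Prod>i | B $ i $ j < 0. x i powi (- (B $ i $ j))))"

definition mutation ::
    "('p::semifield group_ring \<Rightarrow> 'f::field) \<Rightarrow> 'n::finite \<Rightarrow>
      ('n, 'p, 'f) seed \<Rightarrow> ('n, 'p, 'f) seed"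
  where "mutation h k s =
    (let x = cluster s; y = coefficient s; B = exchange_matrix s in
      \<lparr>cluster = (\<lambda>i. if i = k then exchange_polynomial h s k / x k else x i),
       coefficient = (\<lambda>i. if i = k then inverse (y k)
          else y i * y k powi max (B $ k $ i) 0 * (1 \<oplus> y k) powi (- (B $ k $ i))),
       exchange_matrix = (\<chi> i j. if i = k \<or> j = k then - (B $ i $ j)
          else B $ i $ j + sgn (B $ i $ k) * max (B $ i $ k * B $ k $ j) 0)\<rparr>)"


section \<open>Cluster patterns\<close>

text \<open>
  \<open>E t k t'\<close> says that \<open>t\<close> and \<open>t'\<close> are joined by an edge labeled \<open>k\<close>.  A tree is a simple graph in
  which any two vertices are joined by exactly one simple path, given here by its list of vertices.
\<close>

definition labeled_regular_tree :: "('t \<Rightarrow> 'n \<Rightarrow> 't \<Rightarrow> bool) \<Rightarrow> bool"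
  where "labeled_regular_tree E \<longleftrightarrow>
    (\<forall>t k t'. E t k t' \<longrightarrow> E t' k t \<and> t \<noteq> t') \<and>
    (\<forall>t k l t'. E t k t' \<and> E t l t' \<longrightarrow> k = l) \<and>
    (\<forall>t k. \<exists>!t'. E t k t') \<and>
    (\<forall>t t'. \<exists>!p. p \<noteq> [] \<and> distinct p \<and> hd p = t \<and> last p = t' \<and>
      successively (\<lambda>v w. \<exists>k. E v k w) p)"

definition cluster_pattern ::
    "('p::semifield group_ring \<Rightarrow> 'f::field) \<Rightarrow> ('t \<Rightarrow> 'n \<Rightarrow> 't \<Rightarrow> bool) \<Rightarrow>
      ('t \<Rightarrow> ('n::finite, 'p, 'f) seed) \<Rightarrow> bool"
  where "cluster_pattern h E \<S> \<longleftrightarrow>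
    (\<forall>t. is_seed h (\<S> t)) \<and> (\<forall>t k t'. E t k t' \<longrightarrow> \<S> t' = mutation h k (\<S> t))"

definition cluster_variables :: "('t \<Rightarrow> ('n::finite, 'p, 'f) seed) \<Rightarrow> 'f set"
  where "cluster_variables \<S> = (\<Union>t. range (cluster (\<S> t)))"

definition laurent_monomial :: "('n::finite \<Rightarrow> 'f::field) \<Rightarrow> int^'n \<Rightarrow> 'f"
  where "laurent_monomial x a = (\<Prod>i\<in>UNIV. x i powi (a $ i))"

definition cluster_monomials :: "('t \<Rightarrow> ('n::finite, 'p, 'f::field) seed) \<Rightarrow> 'f set"
  where "cluster_monomials \<S> =
    {laurent_monomial (cluster (\<S> t)) a | t a. \<forall>i. 0 \<le> a $ i}"


section \<open>Positivity and d-vectors\<close>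

definition positive_laurent ::
    "('p::semifield group_ring \<Rightarrow> 'f::field) \<Rightarrow> ('n::finite \<Rightarrow> 'f) \<Rightarrow> 'f \<Rightarrow> bool"
  where "positive_laurent h x z \<longleftrightarrow>
    (\<exists>A c. finite A \<and> (\<forall>a\<in>A. c a \<in> NP) \<and> z = (\<Sum>a\<in>A. h (c a) * laurent_monomial x a))"

definition is_d_vector ::
    "('p::semifield group_ring \<Rightarrow> 'f::field) \<Rightarrow> ('n::finite \<Rightarrow> 'f) \<Rightarrow> 'f \<Rightarrow> int^'n \<Rightarrow> bool"
  where "is_d_vector h x z d \<longleftrightarrow>
    (\<exists>f :: ('n, 'p group_ring) mpoly.
      (\<forall>j. \<not> Var j dvd f) \<and> z = eval_mpoly h x f / laurent_monomial x d)"

text \<open>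
  By the Laurent phenomenon there is exactly one such vector when \<open>z\<close> is a cluster variable and \<open>x\<close>
  a cluster of the same cluster pattern.
\<close>

definition d_vector ::
    "('p::semifield group_ring \<Rightarrow> 'f::field) \<Rightarrow> ('n::finite \<Rightarrow> 'f) \<Rightarrow> 'f \<Rightarrow> int^'n"
  where "d_vector h x z = (THE d. is_d_vector h x z d)"

definition positivity_of_cluster_variables ::
    "('p::semifield group_ring \<Rightarrow> 'f::field) \<Rightarrow> ('t \<Rightarrow> ('n::finite, 'p, 'f) seed) \<Rightarrow> bool"
  where "positivity_of_cluster_variables h \<S> \<longleftrightarrow>
    (\<forall>t\<^sub>0. \<forall>z\<in>cluster_variables \<S>. positive_laurent h (cluster (\<S> t\<^sub>0)) z)"

definition positivity_of_d_vectors ::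
    "('p::semifield group_ring \<Rightarrow> 'f::field) \<Rightarrow> ('t \<Rightarrow> ('n::finite, 'p, 'f) seed) \<Rightarrow> bool"
  where "positivity_of_d_vectors h \<S> \<longleftrightarrow>
    (\<forall>t\<^sub>0. \<forall>z\<in>cluster_variables \<S>. z \<notin> range (cluster (\<S> t\<^sub>0)) \<longrightarrow>
      (\<forall>j. 0 \<le> d_vector h (cluster (\<S> t\<^sub>0)) z $ j))"

end

theory Submission
  imports Defs
begin

text \<open>
  A relation \<open>\<Sum>z. h (c z) * z = 0\<close> among cluster monomials is tested, for a given cluster
  monomial \<open>z0\<close> of a cluster \<open>y\<close>, by expanding every \<open>z\<close> as a Laurent polynomial in \<open>y\<close> and comparing
  coefficients at the exponent vector \<open>b\<close> of \<open>z0\<close>.  Since \<open>b\<close> has nonnegative entries, \<open>c z0 = 0\<close>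
  follows once it is known that a cluster monomial whose expansion in \<open>y\<close> contains a monomial
  with nonnegative exponent vector \<open>b\<close> is equal to that monomial
  (\<open>cluster_monomial_with_nonneg_exponent\<close>).

  To see this, let \<open>z\<close> be a monomial in another cluster \<open>x\<close>, and specialise all variables of \<open>x\<close> and
  all elements of the semifield to \<open>1\<close>.  Then \<open>z\<close> becomes \<open>1\<close>, and every variable \<open>y j\<close>, being a
  nonzero Laurent polynomial in \<open>x\<close> with coefficients in \<open>\<nat>\<bbbP>\<close>, becomes an integer at least \<open>1\<close>.
  The expansion of \<open>z\<close> in \<open>y\<close> therefore writes \<open>1\<close> as a sum of positive rationals, in which the term
  with the nonnegative exponent vector \<open>b\<close> is already at least \<open>1\<close>.  Hence that term is the only one,
  its coefficient is an element of the semifield, and every \<open>y j\<close> with \<open>b j > 0\<close> specialises to \<open>1\<close>,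
  which makes it a Laurent monomial in \<open>x\<close> times an element of the semifield
  (\<open>positive_expansion_with_nonneg_monomial\<close>).

  It remains to see that such a \<open>y j\<close> is a variable of \<open>x\<close>.  A negative exponent of \<open>x i\<close> is impossible:
  mutation in direction \<open>i\<close> replaces \<open>x i\<close> by \<open>F / x' i\<close>, where the exchange polynomial \<open>F\<close> specialises
  to \<open>2\<close>, so that Laurentness of \<open>y j\<close> in the mutated cluster would make \<open>1\<close> an even integer
  (\<open>unit_after_mutation_imp_nonneg\<close>).  If \<open>y j\<close> did not belong to \<open>x\<close>, the d-vector hypothesis would
  exclude positive exponents as well, and \<open>y j\<close> would be a constant
  (\<open>cluster_variable_unit_mem_cluster\<close>).  So the monomial with exponent vector \<open>b\<close> in \<open>y\<close> is also a
  monomial in \<open>x\<close>.  It agrees with \<open>z\<close> up to a factor from the semifield, and uniqueness of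
  Laurent expansions in \<open>x\<close> makes the two equal.
\<close>


section \<open>Evaluation on monoid rings\<close>

lemma poly_mapping_eq_sum_single:
  "f = (\<Sum>m\<in>Poly_Mapping.keys f. Poly_Mapping.single m (Poly_Mapping.lookup f m))"
  by (rule poly_mapping_eqI)
    (auto simp: lookup_sum lookup_single when_def in_keys_iff sum.delta)

lemma poly_mapping_mult_eq_sum_single:
  fixes f g :: "'m::comm_monoid_add \<Rightarrow>\<^sub>0 'r::comm_ring_1"
  shows "f * g = (\<Sum>m\<in>Poly_Mapping.keys f. \<Sum>n\<in>Poly_Mapping.keys g.
    Poly_Mapping.single (m + n) (Poly_Mapping.lookup f m * Poly_Mapping.lookup g n))"
  by (subst poly_mapping_eq_sum_single[of f], subst poly_mapping_eq_sum_single[of g])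
    (simp add: sum_product mult_single)

lemma keys_singleton_imp_single:
  fixes f :: "'m \<Rightarrow>\<^sub>0 'r::comm_monoid_add"
  assumes "Poly_Mapping.keys f = {k}"
  shows "f = Poly_Mapping.single k (Poly_Mapping.lookup f k)"
  using poly_mapping_eq_sum_single[of f] assms by simp

lemma lookup_single_zero_mult:
  fixes f :: "'m::comm_monoid_add \<Rightarrow>\<^sub>0 'r::comm_ring_1"
  shows "Poly_Mapping.lookup (Poly_Mapping.single 0 c * f) m = c * Poly_Mapping.lookup f m"
  unfolding mult_map_scale_conv_mult[symmetric] by (simp add: map.rep_eq when_def)

locale comm_ring_hom =
  fixes \<phi> :: "'r::comm_ring_1 \<Rightarrow> 's::comm_ring_1"
  assumes hom_add: "\<phi> (a + b) = \<phi> a + \<phi> b"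
    and hom_mult: "\<phi> (a * b) = \<phi> a * \<phi> b"
    and hom_one: "\<phi> 1 = 1"
begin

lemma hom_zero: "\<phi> 0 = 0"
  using hom_add[of 0 0] by simp

lemma hom_diff: "\<phi> (a - b) = \<phi> a - \<phi> b"
  using hom_add[of "a - b" b] by (simp add: algebra_simps)

lemma hom_sum: "\<phi> (\<Sum>i\<in>A. f i) = (\<Sum>i\<in>A. \<phi> (f i))"
  by (induction A rule: infinite_finite_induct) (simp_all add: hom_zero hom_add)

lemma hom_prod: "\<phi> (\<Prod>i\<in>A. f i) = (\<Prod>i\<in>A. \<phi> (f i))"
  by (induction A rule: infinite_finite_induct) (simp_all add: hom_one hom_mult)

lemma hom_power: "\<phi> (a ^ n) = \<phi> a ^ n"
  by (induction n) (simp_all add: hom_one hom_mult)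

end

text \<open>
  The instances needed are Laurent polynomials evaluated at a cluster, and the two layers of the
  specialisation to \<open>\<int>\<close> at which all variables and all elements of \<open>\<bbbP>\<close> become \<open>1\<close>.
\<close>

definition monoid_ring_eval ::
    "('r::comm_ring_1 \<Rightarrow> 's::comm_ring_1) \<Rightarrow> ('m \<Rightarrow> 's) \<Rightarrow> ('m \<Rightarrow>\<^sub>0 'r) \<Rightarrow> 's"
  where "monoid_ring_eval \<kappa> T f =
    (\<Sum>m\<in>Poly_Mapping.keys f. \<kappa> (Poly_Mapping.lookup f m) * T m)"

locale monoid_ring_evaluation = coeff: comm_ring_hom \<kappa>
  for \<kappa> :: "'r::comm_ring_1 \<Rightarrow> 's::comm_ring_1" +
  fixes T :: "'m::comm_monoid_add \<Rightarrow> 's"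
  assumes T_zero: "T 0 = 1"
    and T_add: "T (a + b) = T a * T b"
begin

lemma eval_superset:
  assumes "finite A" "Poly_Mapping.keys f \<subseteq> A"
  shows "monoid_ring_eval \<kappa> T f = (\<Sum>m\<in>A. \<kappa> (Poly_Mapping.lookup f m) * T m)"
  unfolding monoid_ring_eval_def using assms
  by (intro sum.mono_neutral_left) (auto simp: in_keys_iff coeff.hom_zero)

lemma eval_single: "monoid_ring_eval \<kappa> T (Poly_Mapping.single m c) = \<kappa> c * T m"
  by (subst eval_superset[of "{m}"]) auto

lemma eval_add:
  "monoid_ring_eval \<kappa> T (f + g) = monoid_ring_eval \<kappa> T f + monoid_ring_eval \<kappa> T g"
proof -
  let ?A = "Poly_Mapping.keys f \<union> Poly_Mapping.keys g"
  have "Poly_Mapping.keys (f + g) \<subseteq> ?A"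
    by (rule keys_add)
  then show ?thesis
    by (simp add: eval_superset[of ?A] lookup_add coeff.hom_add distrib_right sum.distrib)
qed

lemma eval_zero: "monoid_ring_eval \<kappa> T 0 = 0"
  by (simp add: monoid_ring_eval_def)

lemma eval_sum:
  "monoid_ring_eval \<kappa> T (\<Sum>i\<in>A. f i) = (\<Sum>i\<in>A. monoid_ring_eval \<kappa> T (f i))"
  by (induction A rule: infinite_finite_induct) (simp_all add: eval_zero eval_add)

lemma eval_mult:
  "monoid_ring_eval \<kappa> T (f * g) = monoid_ring_eval \<kappa> T f * monoid_ring_eval \<kappa> T g"
  by (simp add: poly_mapping_mult_eq_sum_single eval_sum eval_single coeff.hom_mult T_add)
    (simp add: monoid_ring_eval_def sum_product mult_ac)

sublocale comm_ring_hom "monoid_ring_eval \<kappa> T"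
proof
  show "monoid_ring_eval \<kappa> T 1 = 1"
    using eval_single[of 0 1] by (simp add: coeff.hom_one T_zero)
qed (fact eval_add eval_mult)+

end


section \<open>Total mass: the specialisation at one\<close>

definition mass :: "'p::semifield group_ring \<Rightarrow> int"
  where "mass = monoid_ring_eval (\<lambda>c. c) (\<lambda>_. 1)"

definition laurent_mass :: "(int^'n::finite \<Rightarrow>\<^sub>0 'p::semifield group_ring) \<Rightarrow> int"
  where "laurent_mass = monoid_ring_eval mass (\<lambda>_. 1)"

interpretation mass: monoid_ring_evaluation "\<lambda>c::int. c" "\<lambda>_::'p::semifield additive. 1"
  rewrites "monoid_ring_eval (\<lambda>c::int. c) (\<lambda>_::'p additive. 1) = mass"
  by unfold_locales (simp_all add: mass_def)

interpretation laurent_mass: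
  monoid_ring_evaluation "mass :: 'p::semifield group_ring \<Rightarrow> int" "\<lambda>_::int^'n::finite. 1"
  rewrites "monoid_ring_eval (mass :: 'p group_ring \<Rightarrow> int) (\<lambda>_::int^'n. 1) = laurent_mass"
  by unfold_locales
    (simp_all add: laurent_mass_def mass.hom_add mass.hom_mult mass.hom_one)

lemma mass_group_elem [simp]: "mass (group_elem p) = 1"
  by (simp add: group_elem_def mass.eval_single)

lemma group_elem_nonzero [simp]: "group_elem p \<noteq> 0"
  by (metis mass.hom_zero mass_group_elem zero_neq_one)

text \<open>
  Integrality is what makes the specialisation informative: a nonzero positive element has mass at
  least \<open>1\<close>, and mass exactly \<open>1\<close> leaves room for a single term with coefficient \<open>1\<close>.
\<close>

lemma sum_positive_ints_eq_1:
  fixes g :: "'a \<Rightarrow> int"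
  assumes "finite A" "(\<Sum>k\<in>A. g k) = 1" "\<And>k. k \<in> A \<Longrightarrow> 1 \<le> g k"
  shows "\<exists>k. A = {k} \<and> g k = 1"
proof -
  from assms(2) obtain k where k: "k \<in> A"
    by (metis sum.empty all_not_in_conv zero_neq_one)
  have sum_rest: "g k + (\<Sum>l\<in>A - {k}. g l) = 1"
    using assms k by (simp add: sum.remove)
  have "int (card (A - {k})) \<le> (\<Sum>l\<in>A - {k}. g l)"
    using sum_bounded_below[of "A - {k}" 1 g] assms(3) by simp
  with sum_rest assms(3)[OF k] have "card (A - {k}) = 0"
    by linarith
  with assms(1) k have "A = {k}"
    by (metis card_0_eq finite_Diff insert_Diff)
  with assms(2) show ?thesis
    by auto
qed

lemma NP_keys_ge_1:
  assumes "c \<in> NP" "p \<in> Poly_Mapping.keys c"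
  shows "1 \<le> Poly_Mapping.lookup c p"
  using assms unfolding NP_def in_keys_iff by (metis mem_Collect_eq int_one_le_iff_zero_less
      order_less_le)

lemma mass_ge_1:
  assumes "c \<in> NP" "c \<noteq> 0"
  shows "1 \<le> mass c"
proof -
  from assms(2) have "1 \<le> int (card (Poly_Mapping.keys c))"
    by (simp add: Suc_le_eq card_gt_0_iff)
  also have "\<dots> \<le> mass c"
    using sum_bounded_below[of "Poly_Mapping.keys c" 1 "Poly_Mapping.lookup c"]
      NP_keys_ge_1[OF assms(1)]
    by (simp add: mass_def monoid_ring_eval_def)
  finally show ?thesis .
qed

lemma mass_eq_1_imp_group_elem:
  assumes "c \<in> NP" "mass c = 1"
  shows "\<exists>p. c = group_elem p"
proof -
  obtain q where "Poly_Mapping.keys c = {q}" "Poly_Mapping.lookup c q = 1"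
    using sum_positive_ints_eq_1[of "Poly_Mapping.keys c" "Poly_Mapping.lookup c"]
      NP_keys_ge_1[OF assms(1)] assms(2)
    by (auto simp: mass_def monoid_ring_eval_def)
  then have "c = Poly_Mapping.single q 1"
    using keys_singleton_imp_single by metis
  then show ?thesis
    by (cases q) (auto simp: group_elem_def)
qed

definition positive :: "(int^'n::finite \<Rightarrow>\<^sub>0 'p::semifield group_ring) \<Rightarrow> bool"
  where "positive f \<longleftrightarrow> (\<forall>v. Poly_Mapping.lookup f v \<in> NP)"

lemma NP_mult:
  assumes "c \<in> NP" "d \<in> NP"
  shows "c * d \<in> NP"
  using assms unfolding poly_mapping_mult_eq_sum_single[of c d]
  by (auto simp: NP_def lookup_sum lookup_single when_def intro!: sum_nonneg)

lemma positive_one: "positive 1"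
  by (simp add: positive_def NP_def lookup_one when_def)

lemma positive_mult:
  assumes "positive f" "positive g"
  shows "positive (f * g)"
proof -
  have "0 \<le> Poly_Mapping.lookup (Poly_Mapping.lookup f m * Poly_Mapping.lookup g n) q" for m n q
    using assms NP_mult unfolding positive_def NP_def by blast
  then show ?thesis
    unfolding positive_def NP_def poly_mapping_mult_eq_sum_single[of f g]
    by (auto simp: lookup_sum lookup_single when_def intro!: sum_nonneg)
qed

lemma positive_power: "positive f \<Longrightarrow> positive (f ^ n)"
  by (induction n) (simp_all add: positive_one positive_mult)

lemma positive_prod: "(\<And>i. i \<in> A \<Longrightarrow> positive (f i)) \<Longrightarrow> positive (\<Prod>i\<in>A. f i)"
  by (induction A rule: infinite_finite_induct) (simp_all add: positive_one positive_mult)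

lemma positive_mass_lookup_ge_1:
  assumes "positive f" "v \<in> Poly_Mapping.keys f"
  shows "1 \<le> mass (Poly_Mapping.lookup f v)"
  using assms by (auto simp: positive_def in_keys_iff intro: mass_ge_1)

lemma laurent_mass_ge_1:
  assumes "positive f" "f \<noteq> 0"
  shows "1 \<le> laurent_mass f"
proof -
  from assms(2) have "1 \<le> int (card (Poly_Mapping.keys f))"
    by (simp add: Suc_le_eq card_gt_0_iff)
  also have "\<dots> \<le> laurent_mass f"
    using sum_bounded_below[of "Poly_Mapping.keys f" 1 "\<lambda>v. mass (Poly_Mapping.lookup f v)"]
      positive_mass_lookup_ge_1[OF assms(1)]
    by (simp add: laurent_mass_def monoid_ring_eval_def)
  finally show ?thesis .
qed

lemma laurent_mass_eq_1_imp_single: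
  assumes "positive f" "laurent_mass f = 1"
  shows "\<exists>v p. f = Poly_Mapping.single v (group_elem p)"
proof -
  obtain v where v: "Poly_Mapping.keys f = {v}" "mass (Poly_Mapping.lookup f v) = 1"
    using sum_positive_ints_eq_1[of "Poly_Mapping.keys f" "\<lambda>v. mass (Poly_Mapping.lookup f v)"]
      positive_mass_lookup_ge_1[OF assms(1)] assms(2)
    by (auto simp: laurent_mass_def monoid_ring_eval_def)
  then show ?thesis
    using mass_eq_1_imp_group_elem assms(1) keys_singleton_imp_single[OF v(1)]
    unfolding positive_def by metis
qed


section \<open>Laurent polynomials in a cluster\<close>

lemma exists_nonneg_shift:
  fixes A :: "(int^'n::finite) set"
  assumes "finite A"
  shows "\<exists>N::nat. \<forall>v\<in>A. \<forall>i. 0 \<le> v $ i + int N"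
proof -
  let ?s = "\<Sum>v\<in>A. \<Sum>i\<in>UNIV. \<bar>v $ i\<bar>"
  have "0 \<le> v $ i + int (nat ?s)" if "v \<in> A" for v i
  proof -
    have "\<bar>v $ i\<bar> \<le> (\<Sum>i\<in>UNIV. \<bar>v $ i\<bar>)"
      by (rule member_le_sum) auto
    also have "\<dots> \<le> ?s"
      using assms that by (intro member_le_sum) (auto intro: sum_nonneg)
    finally show ?thesis
      by linarith
  qed
  then show ?thesis
    by blast
qed

locale laurent_coordinates =
  fixes h :: "'p::semifield group_ring \<Rightarrow> 'f::field" and x :: "'n::finite \<Rightarrow> 'f"
  assumes h: "ring_embedding h"
    and x: "alg_independent_over (frac_subfield h) x"
begin

sublocale h: comm_ring_hom h
  using h by unfold_locales (auto simp: ring_embedding_def)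

lemma h_eq_iff: "h a = h b \<longleftrightarrow> a = b"
  using h by (auto simp: ring_embedding_def inj_eq)

lemma h_eq_0_iff: "h a = 0 \<longleftrightarrow> a = 0"
  using h_eq_iff[of a 0] by (simp add: h.hom_zero)

lemma h_in_frac_subfield: "h a \<in> frac_subfield h"
proof -
  have "h a = h a / h 1" "(1::'p group_ring) \<noteq> 0"
    by (simp_all add: h.hom_one)
  then show ?thesis
    unfolding frac_subfield_def by blast
qed

lemma algebraic_independenceD:
  assumes "\<And>m. Poly_Mapping.lookup f m \<in> frac_subfield h" "eval_mpoly (\<lambda>c. c) x f = 0"
  shows "f = 0"
  using x assms unfolding alg_independent_over_def by blast

lemma x_nonzero: "x i \<noteq> 0"
proof
  assume "x i = 0"
  then have "eval_mpoly (\<lambda>c. c) x (Var i) = 0"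
    by (auto simp: eval_mpoly_def Var_def lookup_single when_def)
  moreover have "Poly_Mapping.lookup (Var i) m \<in> frac_subfield h" for m
    using h_in_frac_subfield[of 0] h_in_frac_subfield[of 1]
    by (simp add: Var_def lookup_single when_def h.hom_zero h.hom_one)
  ultimately have "(Var i :: ('n, 'f) mpoly) = 0"
    by (rule algebraic_independenceD[rotated])
  then show False
    by (metis Var_def lookup_single_eq lookup_zero zero_neq_one)
qed

lemma laurent_monomial_nonzero: "laurent_monomial x a \<noteq> 0"
  by (simp add: laurent_monomial_def x_nonzero)

lemma laurent_monomial_zero: "laurent_monomial x 0 = 1"
  by (simp add: laurent_monomial_def)

lemma laurent_monomial_add:
  "laurent_monomial x (a + b) = laurent_monomial x a * laurent_monomial x b"
  by (simp add: laurent_monomial_def power_int_add x_nonzero prod.distrib)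

lemma laurent_monomial_minus: "laurent_monomial x (- a) = inverse (laurent_monomial x a)"
  by (simp add: laurent_monomial_def power_int_minus prod_inversef[symmetric])

lemma laurent_monomial_axis: "laurent_monomial x (axis i m) = x i powi m"
proof -
  have "laurent_monomial x (axis i m) = (\<Prod>k\<in>UNIV. if k = i then x k powi m else 1)"
    unfolding laurent_monomial_def by (rule prod.cong) (auto simp: axis_def)
  then show ?thesis
    by simp
qed

lemma laurent_monomial_sum:
  "laurent_monomial x (\<Sum>i\<in>A. a i) = (\<Prod>i\<in>A. laurent_monomial x (a i))"
  by (induction A rule: infinite_finite_induct)
    (simp_all add: laurent_monomial_zero laurent_monomial_add)

definition laurent_eval :: "(int^'n \<Rightarrow>\<^sub>0 'p group_ring) \<Rightarrow> 'f"
  where "laurent_eval = monoid_ring_eval h (laurent_monomial x)"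

sublocale eval: monoid_ring_evaluation h "laurent_monomial x"
  rewrites "monoid_ring_eval h (laurent_monomial x) = laurent_eval"
  by unfold_locales (simp_all add: laurent_eval_def laurent_monomial_zero laurent_monomial_add)

text \<open>
  Multiplying by a large power of \<open>\<Prod>i. x i\<close> turns a Laurent relation into a polynomial one, so
  that algebraic independence applies.
\<close>

lemma laurent_eval_eq_0D:
  assumes "laurent_eval f = 0"
  shows "f = 0"
proof -
  obtain N :: nat where N: "\<forall>v\<in>Poly_Mapping.keys f. \<forall>i. 0 \<le> v $ i + int N"
    using exists_nonneg_shift[of "Poly_Mapping.keys f"] by auto
  define \<nu> :: "int^'n \<Rightarrow> 'n \<Rightarrow>\<^sub>0 nat" where "\<nu> v = Abs_poly_mapping (\<lambda>i. nat (v $ i + int N))" for v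
  have \<nu>: "Poly_Mapping.lookup (\<nu> v) i = nat (v $ i + int N)" for v i
    by (simp add: \<nu>_def)
  have inj: "inj_on \<nu> (Poly_Mapping.keys f)"
  proof (rule inj_onI)
    fix v w assume vw: "v \<in> Poly_Mapping.keys f" "w \<in> Poly_Mapping.keys f" "\<nu> v = \<nu> w"
    have "nat (v $ i + int N) = nat (w $ i + int N)" for i
      using vw(3) by (metis \<nu>)
    with N vw(1,2) have "v $ i = w $ i" for i
      by (metis add_right_cancel eq_nat_nat_iff)
    then show "v = w"
      by (simp add: vec_eq_iff)
  qed
  define g :: "('n, 'f) mpoly" where
    "g = (\<Sum>v\<in>Poly_Mapping.keys f. Poly_Mapping.single (\<nu> v) (h (Poly_Mapping.lookup f v)))"
  have lookup_g: "Poly_Mapping.lookup g m =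
      (\<Sum>v\<in>Poly_Mapping.keys f. h (Poly_Mapping.lookup f v) when \<nu> v = m)" for m
    by (simp add: g_def lookup_sum lookup_single)
  have lookup_g_\<nu>: "Poly_Mapping.lookup g (\<nu> v) = h (Poly_Mapping.lookup f v)"
    if "v \<in> Poly_Mapping.keys f" for v
  proof -
    have "Poly_Mapping.lookup g (\<nu> v) =
        (\<Sum>w\<in>Poly_Mapping.keys f. h (Poly_Mapping.lookup f v) when w = v)"
      unfolding lookup_g using inj that
      by (intro sum.cong) (auto simp: when_def inj_on_eq_iff)
    also have "\<dots> = h (Poly_Mapping.lookup f v)"
      using that by (simp add: when_def)
    finally show ?thesis .
  qed
  have keys_g: "Poly_Mapping.keys g = \<nu> ` Poly_Mapping.keys f"
  proof
    have "Poly_Mapping.lookup g m = 0" if "m \<notin> \<nu> ` Poly_Mapping.keys f" for m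
      unfolding lookup_g using that by (intro sum.neutral) (auto simp: when_def)
    then show "Poly_Mapping.keys g \<subseteq> \<nu> ` Poly_Mapping.keys f"
      by (auto simp: in_keys_iff)
    show "\<nu> ` Poly_Mapping.keys f \<subseteq> Poly_Mapping.keys g"
      by (auto simp: in_keys_iff lookup_g_\<nu> h_eq_0_iff)
  qed
  have monomial: "(\<Prod>i\<in>UNIV. x i ^ Poly_Mapping.lookup (\<nu> v) i) =
      laurent_monomial x (\<chi> i. int N) * laurent_monomial x v"
    if "v \<in> Poly_Mapping.keys f" for v
    unfolding laurent_monomial_def prod.distrib[symmetric]
    by (rule prod.cong)
      (use N that in \<open>auto simp: \<nu> power_int_nonneg_exp[symmetric] power_int_add x_nonzero\<close>)
  have "eval_mpoly (\<lambda>c. c) x g = (\<Sum>v\<in>Poly_Mapping.keys f. h (Poly_Mapping.lookup f v) *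
      (laurent_monomial x (\<chi> i. int N) * laurent_monomial x v))"
    unfolding eval_mpoly_def keys_g by (simp add: sum.reindex[OF inj] lookup_g_\<nu> monomial)
  also have "\<dots> = laurent_monomial x (\<chi> i. int N) * laurent_eval f"
    by (simp add: laurent_eval_def monoid_ring_eval_def sum_distrib_left mult_ac)
  finally have "eval_mpoly (\<lambda>c. c) x g = 0"
    using assms by simp
  moreover have "Poly_Mapping.lookup g m \<in> frac_subfield h" for m
    using h_in_frac_subfield[of 0] h_in_frac_subfield lookup_g_\<nu> keys_g
    by (cases "m \<in> Poly_Mapping.keys g") (auto simp: in_keys_iff h.hom_zero)
  ultimately have "g = 0"
    by (rule algebraic_independenceD[rotated])
  then show ?thesis
    using keys_g by simp
qed

lemma laurent_eval_eq_iff: "laurent_eval f = laurent_eval g \<longleftrightarrow> f = g"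
  using laurent_eval_eq_0D[of "f - g"] by (auto simp: eval.hom_diff)

lemma positive_laurentE:
  assumes "positive_laurent h x z"
  obtains f where "positive f" "z = laurent_eval f"
proof -
  from assms obtain A c where A: "finite A" "\<forall>a\<in>A. c a \<in> NP"
      "z = (\<Sum>a\<in>A. h (c a) * laurent_monomial x a)"
    unfolding positive_laurent_def by blast
  let ?f = "\<Sum>a\<in>A. Poly_Mapping.single a (c a)"
  have "positive ?f"
    using A(2) by (auto simp: positive_def NP_def lookup_sum lookup_single when_def intro!: sum_nonneg)
  moreover have "z = laurent_eval ?f"
    by (simp add: eval.hom_sum eval.eval_single A(3))
  ultimately show ?thesis
    by (rule that)
qed

end


section \<open>Positive expansions of Laurent monomials\<close>

text \<open>
  With \<open>g j \<ge> 1\<close> the mass of \<open>y j\<close> as a Laurent polynomial in \<open>x\<close>, applying the specialisation to the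
  expansion of the monomial in \<open>y\<close> gives \<open>1 = \<Sum>v. mass (L v) * (\<Prod>j. g j powi v j)\<close>.  The summand
  at \<open>v = b\<close> is a positive integer because \<open>b\<close> is nonnegative, and the other summands are positive.
  So \<open>b\<close> is the only exponent vector, and all factors of its summand are \<open>1\<close>.  As the inverses of the
  \<open>y j\<close> need not be Laurent polynomials in \<open>x\<close>, denominators are cleared before specialising.
\<close>

lemma positive_expansion_with_nonneg_monomial:
  fixes x y :: "'n::finite \<Rightarrow> 'f::field"
  assumes x: "laurent_coordinates h x" and y: "laurent_coordinates h y"
    and G: "\<And>j. positive (G j)" "\<And>j. y j = laurent_coordinates.laurent_eval h x (G j)"
    and L: "positive L"
      "laurent_monomial x a = laurent_coordinates.laurent_eval h y L"
    and b: "b \<in> Poly_Mapping.keys L" "\<And>j. 0 \<le> b $ j"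
  shows "\<exists>p. L = Poly_Mapping.single b (group_elem p)"
    and "\<And>j. 0 < b $ j \<Longrightarrow> laurent_mass (G j) = 1"
proof -
  interpret x: laurent_coordinates h x by (fact x)
  interpret y: laurent_coordinates h y by (fact y)
  define g where "g j = laurent_mass (G j)" for j
  have g: "1 \<le> g j" for j
  proof -
    have "G j \<noteq> 0"
      using G(2)[of j] y.x_nonzero[of j] by (auto simp: x.eval.hom_zero)
    then show ?thesis
      unfolding g_def using G(1) by (intro laurent_mass_ge_1)
  qed
  obtain N :: nat where N: "\<forall>v\<in>Poly_Mapping.keys L. \<forall>i. 0 \<le> v $ i + int N"
    using exists_nonneg_shift[of "Poly_Mapping.keys L"] by auto
  \<comment> \<open>\<open>M v\<close> is the monomial in \<open>y\<close> with exponent vector \<open>v\<close>, multiplied by the common denominator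
    \<open>\<Prod>j. y j ^ N\<close> and rewritten in terms of \<open>x\<close>.\<close>
  define M where "M v = (\<Prod>j\<in>UNIV. G j ^ nat (v $ j + int N))" for v :: "int^'n"
  have eval_M: "x.laurent_eval (M v) = laurent_monomial y v * laurent_monomial y (\<chi> i. int N)"
    if "\<And>j. 0 \<le> v $ j + int N" for v
  proof -
    have "x.laurent_eval (M v) = (\<Prod>j\<in>UNIV. y j ^ nat (v $ j + int N))"
      by (simp add: M_def x.eval.hom_prod x.eval.hom_power G(2))
    also have "\<dots> = laurent_monomial y (v + (\<chi> i. int N))"
      by (simp add: laurent_monomial_def power_int_nonneg_exp that)
    finally show ?thesis
      by (simp add: y.laurent_monomial_add)
  qed
  have "x.laurent_eval (Poly_Mapping.single a 1 * M 0) =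
      laurent_monomial x a * laurent_monomial y (\<chi> i. int N)"
    by (simp add: x.eval.hom_mult x.eval.eval_single x.h.hom_one eval_M y.laurent_monomial_zero)
  also have "\<dots> = (\<Sum>v\<in>Poly_Mapping.keys L.
      h (Poly_Mapping.lookup L v) * (laurent_monomial y v * laurent_monomial y (\<chi> i. int N)))"
    by (simp add: L(2) y.laurent_eval_def monoid_ring_eval_def sum_distrib_right mult.assoc)
  also have "\<dots> = x.laurent_eval
      (\<Sum>v\<in>Poly_Mapping.keys L. Poly_Mapping.single 0 (Poly_Mapping.lookup L v) * M v)"
    using N by (simp add: x.eval.hom_sum x.eval.hom_mult x.eval.eval_single
        x.laurent_monomial_zero eval_M)
  finally have "Poly_Mapping.single a 1 * M 0 =
      (\<Sum>v\<in>Poly_Mapping.keys L. Poly_Mapping.single 0 (Poly_Mapping.lookup L v) * M v)"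
    by (simp add: x.laurent_eval_eq_iff)
  from arg_cong[OF this, of laurent_mass]
  have mass_eq: "laurent_mass (M 0) =
      (\<Sum>v\<in>Poly_Mapping.keys L. mass (Poly_Mapping.lookup L v) * laurent_mass (M v))"
    by (simp add: laurent_mass.hom_mult laurent_mass.hom_sum laurent_mass.eval_single
        mass.hom_one)
  have mass_M: "laurent_mass (M v) = (\<Prod>j\<in>UNIV. g j ^ nat (v $ j + int N))" for v
    by (simp add: M_def laurent_mass.hom_prod laurent_mass.hom_power g_def)
  have mass_M_ge_1: "1 \<le> laurent_mass (M v)" for v
    unfolding mass_M by (intro prod_ge_1 one_le_power g)
  define gb where "gb = (\<Prod>j\<in>UNIV. g j ^ nat (b $ j))"
  have gb: "1 \<le> gb"
    unfolding gb_def by (intro prod_ge_1 one_le_power g)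
  have mass_Mb: "laurent_mass (M b) = gb * laurent_mass (M 0)"
    by (simp add: mass_M gb_def prod.distrib[symmetric] power_add[symmetric] nat_add_distrib b(2))
  have term_ge_1: "1 \<le> mass (Poly_Mapping.lookup L v) * laurent_mass (M v)"
    if "v \<in> Poly_Mapping.keys L" for v
    using mult_mono[OF positive_mass_lookup_ge_1[OF L(1) that] mass_M_ge_1[of v]]
      positive_mass_lookup_ge_1[OF L(1) that] by simp
  define c where "c = mass (Poly_Mapping.lookup L b)"
  have c: "1 \<le> c"
    unfolding c_def by (rule positive_mass_lookup_ge_1[OF L(1) b(1)])
  define R where "R = (\<Sum>v\<in>Poly_Mapping.keys L - {b}.
      mass (Poly_Mapping.lookup L v) * laurent_mass (M v))"
  have R: "int (card (Poly_Mapping.keys L - {b})) \<le> R"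
    unfolding R_def using sum_bounded_below[of "Poly_Mapping.keys L - {b}" 1
      "\<lambda>v. mass (Poly_Mapping.lookup L v) * laurent_mass (M v)"] term_ge_1 by simp
  have total: "laurent_mass (M 0) = c * gb * laurent_mass (M 0) + R"
    using mass_eq b(1) by (simp add: sum.remove R_def c_def mass_Mb)
  have cgb: "1 \<le> c * gb"
    using mult_mono[OF c gb] c by simp
  have "c * gb = 1"
  proof (rule ccontr)
    assume "c * gb \<noteq> 1"
    with cgb have "2 \<le> c * gb"
      by linarith
    then have "2 * laurent_mass (M 0) \<le> c * gb * laurent_mass (M 0)"
      using mass_M_ge_1[of 0] by (intro mult_right_mono) auto
    with total R mass_M_ge_1[of 0] show False
      by linarith
  qed
  with c gb have c1: "c = 1" and gb1: "gb = 1"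
    by (auto simp: zmult_eq_1_iff)
  from total R have "card (Poly_Mapping.keys L - {b}) = 0"
    by (simp add: c1 gb1)
  with b(1) have keys_L: "Poly_Mapping.keys L = {b}"
    by (metis card_0_eq finite_Diff finite_keys insert_Diff)
  obtain p where "Poly_Mapping.lookup L b = group_elem p"
    using mass_eq_1_imp_group_elem L(1) c1 unfolding positive_def c_def by blast
  with keys_singleton_imp_single[OF keys_L]
  show "\<exists>p. L = Poly_Mapping.single b (group_elem p)"
    by metis
  show "laurent_mass (G j) = 1" if "0 < b $ j" for j
  proof (rule ccontr)
    assume "laurent_mass (G j) \<noteq> 1"
    with g[of j] have "1 < g j"
      by (simp add: g_def)
    then have "1 < g j ^ nat (b $ j)"
      using that by (intro one_less_power) auto
    also have "\<dots> \<le> g j ^ nat (b $ j) * (\<Prod>i\<in>UNIV - {j}. g i ^ nat (b $ i))"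
    proof -
      have "1 \<le> (\<Prod>i\<in>UNIV - {j}. g i ^ nat (b $ i))"
        by (intro prod_ge_1 one_le_power g)
      moreover have "0 \<le> g j ^ nat (b $ j)"
        using g[of j] by simp
      ultimately show ?thesis
        by (metis mult.right_neutral mult_left_mono)
    qed
    also have "\<dots> = gb"
      by (simp add: gb_def prod.remove[of UNIV j])
    finally show False
      by (simp add: gb1)
  qed
qed


section \<open>Cluster variables that are Laurent monomials\<close>

text \<open>
  By uniqueness of Laurent expansions the numerator of a Laurent monomial is itself a monomial, and
  a monomial divisible by no variable is constant.
\<close>

lemma (in laurent_coordinates) is_d_vector_unit_iff:
  "is_d_vector h x (h (group_elem p) * laurent_monomial x v) d \<longleftrightarrow> d = - v"
proof
  assume d: "d = - v"
  let ?f = "Poly_Mapping.single 0 (group_elem p) :: ('n, 'p group_ring) mpoly"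
  have f_keys: "Poly_Mapping.keys ?f = {0}"
    by simp
  have "\<not> Var j dvd ?f" for j
  proof
    assume "Var j dvd ?f"
    then obtain g where g: "?f = Var j * g"
      by (auto simp: dvd_def)
    have "0 \<in> Poly_Mapping.keys (Var j * g)"
      using f_keys g by (metis singletonI)
    then obtain m where "(0 :: 'n \<Rightarrow>\<^sub>0 nat) = Poly_Mapping.single j 1 + m"
      using keys_mult[of "Var j" g] by (auto simp: Var_def)
    then have "Poly_Mapping.lookup (0 :: 'n \<Rightarrow>\<^sub>0 nat) j = 1 + Poly_Mapping.lookup m j"
      by (metis lookup_add lookup_single_eq)
    then show False
      by simp
  qed
  moreover have "h (group_elem p) * laurent_monomial x v =
      eval_mpoly h x ?f / laurent_monomial x d"
    unfolding d laurent_monomial_minus divide_inverse by (simp add: eval_mpoly_def)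
  ultimately show "is_d_vector h x (h (group_elem p) * laurent_monomial x v) d"
    unfolding is_d_vector_def by blast
next
  assume "is_d_vector h x (h (group_elem p) * laurent_monomial x v) d"
  then obtain f :: "('n, 'p group_ring) mpoly" where f: "\<And>j. \<not> Var j dvd f"
      "h (group_elem p) * laurent_monomial x v = eval_mpoly h x f / laurent_monomial x d"
    unfolding is_d_vector_def by blast
  define \<nu> :: "('n \<Rightarrow>\<^sub>0 nat) \<Rightarrow> int^'n" where "\<nu> m = (\<chi> i. int (Poly_Mapping.lookup m i))" for m
  have inj: "\<nu> m = \<nu> n \<longleftrightarrow> m = n" for m n
    by (auto simp: \<nu>_def vec_eq_iff intro: poly_mapping_eqI)
  define F where
    "F = (\<Sum>m\<in>Poly_Mapping.keys f. Poly_Mapping.single (\<nu> m) (Poly_Mapping.lookup f m))"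
  have "laurent_eval F = eval_mpoly h x f"
    by (simp add: F_def eval.hom_sum eval.eval_single eval_mpoly_def laurent_monomial_def \<nu>_def)
  also have "\<dots> = h (group_elem p) * laurent_monomial x (v + d)"
    using f(2) by (simp add: laurent_monomial_nonzero laurent_monomial_add field_simps)
  also have "\<dots> = laurent_eval (Poly_Mapping.single (v + d) (group_elem p))"
    by (simp add: eval.eval_single)
  finally have F: "F = Poly_Mapping.single (v + d) (group_elem p)"
    by (simp add: laurent_eval_eq_iff)
  have lookup_F: "Poly_Mapping.lookup F (\<nu> m) = Poly_Mapping.lookup f m" for m
    by (simp add: F_def lookup_sum lookup_single inj when_def in_keys_iff)
  have f_keys: "\<nu> m = v + d" if "m \<in> Poly_Mapping.keys f" for m
    using lookup_F[of m] that by (auto simp: F lookup_single when_def in_keys_iff split: if_splits)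
  have "F \<noteq> 0"
    unfolding F by (metis group_elem_nonzero lookup_single_eq lookup_zero)
  then have "Poly_Mapping.keys f \<noteq> {}"
    unfolding F_def by auto
  then obtain m where m: "m \<in> Poly_Mapping.keys f"
    by blast
  have "Poly_Mapping.keys f = {m}"
  proof -
    have "m' = m" if "m' \<in> Poly_Mapping.keys f" for m'
      by (metis f_keys[OF that] f_keys[OF m] inj)
    with m show ?thesis
      by blast
  qed
  then have f_single: "f = Poly_Mapping.single m (Poly_Mapping.lookup f m)"
    by (rule keys_singleton_imp_single)
  have "Poly_Mapping.lookup m j = 0" for j
  proof (rule ccontr)
    assume "Poly_Mapping.lookup m j \<noteq> 0"
    then have "m = Poly_Mapping.single j 1 + (m - Poly_Mapping.single j 1)"
      by (intro poly_mapping_eqI) (auto simp: lookup_add lookup_minus lookup_single when_def)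
    then have "f = Var j * Poly_Mapping.single (m - Poly_Mapping.single j 1) (Poly_Mapping.lookup f m)"
      by (subst f_single) (simp add: Var_def mult_single)
    with f(1)[of j] show False
      by (metis dvd_triv_left)
  qed
  then have "\<nu> m = 0"
    by (simp add: \<nu>_def vec_eq_iff)
  with f_keys[OF m] show "d = - v"
    by (simp add: eq_neg_iff_add_eq_0 add.commute)
qed

lemma (in laurent_coordinates) d_vector_unit:
  "d_vector h x (h (group_elem p) * laurent_monomial x v) = - v"
  unfolding d_vector_def by (rule the_equality) (simp_all add: is_d_vector_unit_iff)

lemma skew_symmetrizable_diagonal:
  assumes "skew_symmetrizable B"
  shows "B $ i $ i = 0"
proof -
  from assms obtain S :: "int^'a^'a" where S: "\<forall>i j. i \<noteq> j \<longrightarrow> S $ i $ j = 0" "\<forall>i. 0 < S $ i $ i"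
      "transpose (S ** B) = - (S ** B)"
    unfolding skew_symmetrizable_def by blast
  have "(S ** B) $ i $ i = (\<Sum>k\<in>UNIV. S $ i $ k * B $ k $ i)"
    by (simp add: matrix_matrix_mult_def)
  also have "\<dots> = (\<Sum>k\<in>{i}. S $ i $ k * B $ k $ i)"
    using S(1) by (intro sum.mono_neutral_right) auto
  finally have "(S ** B) $ i $ i = S $ i $ i * B $ i $ i"
    by simp
  moreover have "(S ** B) $ i $ i = - ((S ** B) $ i $ i)"
    using arg_cong[OF S(3), of "\<lambda>M. M $ i $ i"] by (simp add: transpose_def)
  ultimately show ?thesis
    using S(2) by (metis equal_neg_zero mult_eq_0_iff less_irrefl)
qed

text \<open>
  Write \<open>x\<close> for the cluster of \<open>s\<close>.  If \<open>v i = - n < 0\<close>, then \<open>x i = F / x' i\<close> shows that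
  \<open>z * F ^ n\<close> is a Laurent monomial in the mutated cluster \<open>x'\<close> up to an element of \<open>\<bbbP>\<close>, hence of
  mass \<open>1\<close>.  The exchange polynomial \<open>F\<close> does not
  involve \<open>x i\<close>, so it is a Laurent polynomial in \<open>x'\<close>, and it has mass \<open>2\<close>.  As \<open>z\<close> has an integral
  mass too, \<open>2 ^ n\<close> would divide \<open>1\<close>.
\<close>

lemma unit_after_mutation_imp_nonneg:
  fixes s :: "('n::finite, 'p::semifield, 'f::field) seed"
  assumes x: "laurent_coordinates h (cluster s)"
    and x': "laurent_coordinates h (cluster (mutation h i s))"
    and B: "skew_symmetrizable (exchange_matrix s)"
    and z: "z = h (group_elem p) * laurent_monomial (cluster s) v"
      "z = laurent_coordinates.laurent_eval h (cluster (mutation h i s)) L"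
  shows "0 \<le> v $ i"
proof (rule ccontr)
  assume neg: "\<not> 0 \<le> v $ i"
  define n where "n = nat (- (v $ i))"
  have n: "v $ i = - int n" "0 < n"
    using neg by (auto simp: n_def)
  define b where "b k = exchange_matrix s $ k $ i" for k
  define F where "F = exchange_polynomial h s i"
  let ?x = "cluster s" and ?x' = "cluster (mutation h i s)"
  interpret x: laurent_coordinates h ?x by (fact x)
  interpret x': laurent_coordinates h ?x' by (fact x')
  have x'_i: "?x' i = F / ?x i" and x'_k: "k \<noteq> i \<Longrightarrow> ?x' k = ?x k" for k
    by (simp_all add: mutation_def Let_def F_def)
  have b_i: "b i = 0"
    using skew_symmetrizable_diagonal[OF B] by (simp add: b_def)
  have mono: "laurent_monomial ?x' (\<chi> k. if P k then c k else 0) = (\<Prod>k | P k. ?x k powi c k)"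
    if "\<not> P i" for P and c :: "'n \<Rightarrow> int"
  proof -
    have "laurent_monomial ?x' (\<chi> k. if P k then c k else 0) = (\<Prod>k | P k. ?x' k powi c k)"
      unfolding laurent_monomial_def by (intro prod.mono_neutral_cong_right) auto
    also have "\<dots> = (\<Prod>k | P k. ?x k powi c k)"
    proof (rule prod.cong)
      fix k assume "k \<in> {k. P k}"
      with that have "k \<noteq> i"
        by auto
      then show "?x' k powi c k = ?x k powi c k"
        by (simp add: x'_k)
    qed simp
    finally show ?thesis .
  qed
  obtain p1 p2 where "F = h (group_elem p1) * (\<Prod>k | 0 < b k. ?x k powi b k) +
      h (group_elem p2) * (\<Prod>k | b k < 0. ?x k powi (- b k))"
    unfolding F_def exchange_polynomial_def Let_def b_def by blast
  then have F: "F = x'.laurent_eval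
      (Poly_Mapping.single (\<chi> k. if 0 < b k then b k else 0) (group_elem p1) +
        Poly_Mapping.single (\<chi> k. if b k < 0 then - b k else 0) (group_elem p2))"
      (is "F = x'.laurent_eval ?P")
    by (simp add: x'.eval.hom_add x'.eval.eval_single mono b_i)
  have mass_P: "laurent_mass ?P = 2"
    by (simp add: laurent_mass.hom_add laurent_mass.eval_single)
  let ?w = "\<chi> k. if k = i then int n else v $ k"
  let ?rest = "\<Prod>k\<in>UNIV - {i}. ?x k powi v $ k"
  have "laurent_monomial ?x v * F ^ n = ?rest * ?x' i ^ n"
  proof -
    have "laurent_monomial ?x v = ?x i powi (- int n) * ?rest"
      unfolding laurent_monomial_def by (simp add: prod.remove[of UNIV i] n(1))
    moreover have "F ^ n = ?x' i ^ n * ?x i ^ n"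
      by (simp add: x'_i x.x_nonzero power_divide)
    ultimately show ?thesis
      by (simp add: power_int_minus x.x_nonzero)
  qed
  also have "\<dots> = laurent_monomial ?x' ?w"
    unfolding laurent_monomial_def by (simp add: prod.remove[of UNIV i] x'_k mult.commute)
  finally have "z * F ^ n = h (group_elem p) * laurent_monomial ?x' ?w"
    by (simp add: z(1) mult.assoc)
  then have "x'.laurent_eval (L * ?P ^ n) =
      x'.laurent_eval (Poly_Mapping.single ?w (group_elem p))"
    using z(2) F by (simp add: x'.eval.hom_mult x'.eval.hom_power x'.eval.eval_single)
  then have "L * ?P ^ n = Poly_Mapping.single ?w (group_elem p)"
    by (simp only: x'.laurent_eval_eq_iff)
  from arg_cong[OF this, of laurent_mass]
  have "laurent_mass L * 2 ^ n = 1"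
    by (simp add: laurent_mass.hom_mult laurent_mass.hom_power laurent_mass.eval_single
        mass_P del: laurent_mass.hom_add)
  then have "even (1::int)"
    using n(2) by (metis dvd_mult dvd_power)
  then show False
    by simp
qed


section \<open>Linear independence of cluster monomials\<close>

lemma laurent_coordinates_cluster:
  assumes "rational_function_field h u" "cluster_pattern h E \<S>"
  shows "laurent_coordinates h (cluster (\<S> t))"
  using assms
  unfolding rational_function_field_def cluster_pattern_def is_seed_def
    generating_transcendence_basis_def laurent_coordinates_def by blast

text \<open>
  Write \<open>x\<close> for the cluster at \<open>t\<close>.  Mutating it in every direction shows that \<open>v\<close> is nonnegative.
  The d-vector of \<open>z\<close> is \<open>- v\<close>, so if \<open>z\<close> were not in the cluster, \<open>v\<close> would be \<open>0\<close> and \<open>z\<close> a constant, contradicting algebraic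
  independence of the cluster that contains \<open>z\<close>.
\<close>

lemma cluster_variable_unit_mem_cluster:
  fixes h :: "'p::semifield group_ring \<Rightarrow> 'f::field"
    and \<S> :: "'t \<Rightarrow> ('n::finite, 'p, 'f) seed"
  assumes field: "rational_function_field h u"
    and tree: "labeled_regular_tree E"
    and pattern: "cluster_pattern h E \<S>"
    and pos: "positivity_of_cluster_variables h \<S>"
    and dpos: "positivity_of_d_vectors h \<S>"
    and z: "z \<in> cluster_variables \<S>"
    and unit: "z = h (group_elem p) * laurent_monomial (cluster (\<S> t)) v"
  shows "z \<in> range (cluster (\<S> t))"
proof (rule ccontr)
  assume notin: "z \<notin> range (cluster (\<S> t))"
  note coords = laurent_coordinates_cluster[OF field pattern]
  interpret x: laurent_coordinates h "cluster (\<S> t)" by (rule coords)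
  have "0 \<le> v $ i" for i
  proof -
    obtain t' where "E t i t'"
      using tree unfolding labeled_regular_tree_def by metis
    with pattern have t': "\<S> t' = mutation h i (\<S> t)"
      unfolding cluster_pattern_def by blast
    interpret x': laurent_coordinates h "cluster (\<S> t')" by (rule coords)
    obtain L where "z = x'.laurent_eval L"
      using pos z x'.positive_laurentE unfolding positivity_of_cluster_variables_def by metis
    with unit coords[of t] coords[of t'] pattern show ?thesis
      unfolding t' cluster_pattern_def is_seed_def
      by (intro unit_after_mutation_imp_nonneg[of h "\<S> t" i z p v L]) auto
  qed
  moreover have "0 \<le> - v $ i" for i
    using dpos z notin x.d_vector_unit[of p v] unit
    unfolding positivity_of_d_vectors_def by (metis vector_uminus_component)
  ultimately have v: "v = 0"
    by (simp add: vec_eq_iff order_antisym)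
  obtain t1 j where z': "z = cluster (\<S> t1) j"
    using z by (auto simp: cluster_variables_def)
  interpret y: laurent_coordinates h "cluster (\<S> t1)" by (rule coords)
  have "y.laurent_eval (Poly_Mapping.single (axis j 1) 1) =
      y.laurent_eval (Poly_Mapping.single 0 (group_elem p))"
    using z' unit v by (simp add: y.eval.eval_single y.laurent_monomial_axis
        y.laurent_monomial_zero x.laurent_monomial_zero x.h.hom_one)
  then have "Poly_Mapping.single (axis j (1::int)) (1 :: 'p group_ring) =
      Poly_Mapping.single 0 (group_elem p)"
    by (simp only: y.laurent_eval_eq_iff)
  from arg_cong[OF this, of Poly_Mapping.keys]
  have "axis j (1::int) = 0"
    by simp
  then have "axis j (1::int) $ j = 0"
    by simp
  then show False
    by (simp add: axis_nth)
qed

text \<open>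
  This is the proper Laurent monomial property: apart from the monomials in the cluster at \<open>t0\<close>
  themselves, only Laurent monomials with a negative exponent occur in expansions of cluster
  monomials.
\<close>

lemma cluster_monomial_with_nonneg_exponent:
  fixes h :: "'p::semifield group_ring \<Rightarrow> 'f::field"
    and \<S> :: "'t \<Rightarrow> ('n::finite, 'p, 'f) seed"
  assumes field: "rational_function_field h u"
    and tree: "labeled_regular_tree E"
    and pattern: "cluster_pattern h E \<S>"
    and pos: "positivity_of_cluster_variables h \<S>"
    and dpos: "positivity_of_d_vectors h \<S>"
    and z: "z \<in> cluster_monomials \<S>"
  shows "\<exists>L. z = laurent_coordinates.laurent_eval h (cluster (\<S> t0)) L \<and>
    (\<forall>b\<in>Poly_Mapping.keys L. (\<forall>j. 0 \<le> b $ j) \<longrightarrow> z = laurent_monomial (cluster (\<S> t0)) b)"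
proof -
  obtain t a where a: "z = laurent_monomial (cluster (\<S> t)) a" "\<And>k. 0 \<le> a $ k"
    using z unfolding cluster_monomials_def by blast
  let ?x = "cluster (\<S> t)" and ?y = "cluster (\<S> t0)"
  note coords = laurent_coordinates_cluster[OF field pattern]
  interpret x: laurent_coordinates h ?x by (rule coords)
  interpret y: laurent_coordinates h ?y by (rule coords)
  have "\<exists>f. positive f \<and> ?x k = y.laurent_eval f" for k
    using pos y.positive_laurentE[of "?x k"]
    unfolding positivity_of_cluster_variables_def cluster_variables_def by blast
  then obtain H where H: "\<And>k. positive (H k)" "\<And>k. ?x k = y.laurent_eval (H k)"
    by metis
  have "\<exists>f. positive f \<and> ?y j = x.laurent_eval f" for j
    using pos x.positive_laurentE[of "?y j"]
    unfolding positivity_of_cluster_variables_def cluster_variables_def by blast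
  then obtain G where G: "\<And>j. positive (G j)" "\<And>j. ?y j = x.laurent_eval (G j)"
    by metis
  define L where "L = (\<Prod>k\<in>UNIV. H k ^ nat (a $ k))"
  have L: "positive L"
    unfolding L_def by (intro positive_prod positive_power H)
  have z_L: "z = y.laurent_eval L"
    by (simp add: a L_def y.eval.hom_prod y.eval.hom_power H(2)[symmetric] laurent_monomial_def
        power_int_nonneg_exp)
  have "z = laurent_monomial ?y b"
    if b: "b \<in> Poly_Mapping.keys L" "\<forall>j. 0 \<le> b $ j" for b
  proof -
    note expansion = positive_expansion_with_nonneg_monomial[OF coords coords G L
        z_L[unfolded a(1)] b(1) b(2)[rule_format]]
    from expansion(1) obtain p where p: "L = Poly_Mapping.single b (group_elem p)"
      by blast
    have "\<exists>k. ?y j = ?x k" if b_j: "0 < b $ j" for j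
    proof -
      obtain v q where "G j = Poly_Mapping.single v (group_elem q)"
        using laurent_mass_eq_1_imp_single[OF G(1) expansion(2)[OF b_j]] by blast
      then have "?y j = h (group_elem q) * laurent_monomial ?x v"
        by (simp add: G(2) x.eval.eval_single)
      moreover have "?y j \<in> cluster_variables \<S>"
        by (auto simp: cluster_variables_def)
      ultimately show ?thesis
        using cluster_variable_unit_mem_cluster[OF field tree pattern pos dpos] by blast
    qed
    then obtain \<sigma> where \<sigma>: "\<And>j. 0 < b $ j \<Longrightarrow> ?y j = ?x (\<sigma> j)"
      by metis
    \<comment> \<open>Where \<open>b $ j = 0\<close>, the index \<open>\<sigma> j\<close> is arbitrary, but then \<open>axis (\<sigma> j) 0 = 0\<close>.\<close>
    define a' where "a' = (\<Sum>j\<in>UNIV. axis (\<sigma> j) (b $ j))"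
    have "?y j powi (b $ j) = ?x (\<sigma> j) powi (b $ j)" for j
      using \<sigma>[of j] b(2) by (cases "b $ j = 0") (auto simp: order_less_le)
    then have y_b: "laurent_monomial ?y b = laurent_monomial ?x a'"
      unfolding a'_def x.laurent_monomial_sum x.laurent_monomial_axis
      by (simp add: laurent_monomial_def)
    have "x.laurent_eval (Poly_Mapping.single a 1) =
        x.laurent_eval (Poly_Mapping.single a' (group_elem p))"
      using z_L a(1) by (simp add: p x.eval.eval_single y.eval.eval_single x.h.hom_one y_b)
    then have "Poly_Mapping.single a (1 :: 'p group_ring) = Poly_Mapping.single a' (group_elem p)"
      by (simp only: x.laurent_eval_eq_iff)
    from arg_cong[OF this, of Poly_Mapping.keys] have "a = a'"
      by simp
    then show ?thesis
      by (simp add: a(1) y_b)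
  qed
  with z_L show ?thesis
    by blast
qed

theorem proposition6p7:
  fixes h :: "'p::semifield group_ring \<Rightarrow> 'f::field"
    and u :: "'n::finite \<Rightarrow> 'f"
    and E :: "'t \<Rightarrow> 'n \<Rightarrow> 't \<Rightarrow> bool"
    and \<S> :: "'t \<Rightarrow> ('n, 'p, 'f) seed"
  assumes "rational_function_field h u"
    and "labeled_regular_tree E"
    and "cluster_pattern h E \<S>"
    and "positivity_of_cluster_variables h \<S>"
    and "positivity_of_d_vectors h \<S>"
  shows "module.independent (\<lambda>a z. h a * z) (cluster_monomials \<S>)"
proof -
  note coords = laurent_coordinates_cluster[OF assms(1,3)]
  interpret h: comm_ring_hom h
    using assms(1) by unfold_locales (auto simp: rational_function_field_def ring_embedding_def)
  interpret module "\<lambda>a z. h a * z"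
    by unfold_locales (simp_all add: algebra_simps h.hom_add h.hom_mult h.hom_one)
  show ?thesis
    unfolding independent_explicit_module
  proof (intro allI impI)
    fix Z c z0
    assume Z: "finite Z" "Z \<subseteq> cluster_monomials \<S>" "(\<Sum>z\<in>Z. h (c z) * z) = 0" "z0 \<in> Z"
    obtain t b where b: "z0 = laurent_monomial (cluster (\<S> t)) b" "\<forall>j. 0 \<le> b $ j"
      using Z(2,4) unfolding cluster_monomials_def by blast
    interpret x: laurent_coordinates h "cluster (\<S> t)" by (rule coords)
    have "\<forall>z\<in>Z. \<exists>L. z = x.laurent_eval L \<and> (\<forall>b\<in>Poly_Mapping.keys L. (\<forall>j. 0 \<le> b $ j) \<longrightarrow>
        z = laurent_monomial (cluster (\<S> t)) b)"
      using cluster_monomial_with_nonneg_exponent[OF assms] Z(2) by blast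
    then obtain L where L: "\<And>z. z \<in> Z \<Longrightarrow> z = x.laurent_eval (L z)"
        "\<And>z b. z \<in> Z \<Longrightarrow> b \<in> Poly_Mapping.keys (L z) \<Longrightarrow> \<forall>j. 0 \<le> b $ j \<Longrightarrow>
          z = laurent_monomial (cluster (\<S> t)) b"
      by metis
    have other: "Poly_Mapping.lookup (L z) b = 0" if "z \<in> Z - {z0}" for z
      using L(2)[of z b] that b by (auto simp: in_keys_iff)
    have "x.laurent_eval (L z0) = x.laurent_eval (Poly_Mapping.single b 1)"
      using L(1)[OF Z(4)] b(1) by (simp add: x.eval.eval_single h.hom_one)
    then have L_z0: "L z0 = Poly_Mapping.single b 1"
      by (simp only: x.laurent_eval_eq_iff)
    have "x.laurent_eval (\<Sum>z\<in>Z. Poly_Mapping.single 0 (c z) * L z) = (\<Sum>z\<in>Z. h (c z) * z)"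
      by (simp add: x.eval.hom_sum x.eval.hom_mult x.eval.eval_single x.laurent_monomial_zero
          L(1)[symmetric] cong: sum.cong)
    with Z(3) have "(\<Sum>z\<in>Z. Poly_Mapping.single 0 (c z) * L z) = 0"
      by (intro x.laurent_eval_eq_0D) simp
    from arg_cong[OF this, of "\<lambda>f. Poly_Mapping.lookup f b"]
    have "0 = (\<Sum>z\<in>Z. c z * Poly_Mapping.lookup (L z) b)"
      by (simp add: lookup_sum lookup_single_zero_mult)
    also have "\<dots> = c z0"
      using Z(1,4) other by (simp add: sum.remove[of Z z0] L_z0)
    finally show "c z0 = 0"
      by simp
  qed
qed

end
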